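(* For every $\varphi\in\mathsf{Form}_\Box$: if $\mathsf{iK}+\mathsf{bem}\vdash\varphi$, then $\mathcal{MM}(\mathsf{CPC},\mathsf{IPC})\models\varphi$.
   Context: The modal language $\mathsf{Form}_\Box$ is generated by $\top$, $\bot$, propositional variables, $\wedge,\vee,\to$ and $\Box$; $\neg\varphi$ abbreviates $\varphi\to\bot$. $\mathsf{IPC}$ (over the modal language) is the Hilbert system whose axioms are all instances, with $A,B,C\in\mathsf{Form}_\Box$, of $A\to(B\to A)$; $(A\to B)\to((A\to(B\to C))\to(A\to C))$; $A\to(A\vee B)$; $B\to(A\vee B)$; $(A\vee B)\to((A\to C)\to((B\to C)\to C))$; $A\to(B\to(A\wedge B))$; $(A\wedge B)\to A$; $(A\wedge B)\to B$; $\bot\to A$; its only rule is modus ponens. $\mathsf{CPC}$ adds $\neg A\vee A$. $\Gamma\vdash_L\varphi$ denotes derivability from hypotheses $\Gamma$ using axioms of $L$ and modus ponens. $\mathsf{iK}+\mathsf{bem}$ is the least set of formulas containing all $\mathsf{IPC}$ axioms (instantiated in $\mathsf{Form}_\Box$), all instances of $\Box(\varphi\to\psi)\to(\Box\varphi\to\Box\psi)$ and of $\Box\varphi\vee\neg\Box\varphi$, and closed under modus ponens and necessitation (from $\varphi$ infer $\Box\varphi$). The class $\mathcal{MM}(\mathsf{CPC},\mathsf{IPC})$ consists of triples $\langle W,R,\{T_w\}_{w\in W}\rangle$ with $W\ne\emptyset$, $R\subseteq W\times W$, $T_w\subseteq\mathsf{Form}_\Box$, such that for each $w$ there is $L_w\in\{\mathsf{CPC},\mathsf{IPC}\}$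 with: (1) $\bot\notin T_w$; (2) $T_w\vdash_{L_w}\varphi\Rightarrow\varphi\in T_w$; (3) $\Box\varphi\in T_w$ iff $\varphi\in T_v$ for all $v$ with $wRv$; (4) $\neg\Box\varphi\in T_w$ iff $\varphi\notin T_v$ for some $v$ with $wRv$. $\mathcal{MM}(\mathsf{CPC},\mathsf{IPC})\models\varphi$ means $\varphi\in T_w$ for every such model and every $w\in W$. *)

theory Defs
  imports Main
begin

datatype 'p form =
    Top (\<open>\<^bold>\<top>\<close>)
  | Bot (\<open>\<^bold>\<bottom>\<close>)
  | Var 'p
  | Conj "'p form" "'p form" (infixr \<open>\<^bold>\<and>\<close> 75)
  | Disj "'p form" "'p form" (infixr \<open>\<^bold>\<or>\<close> 74)
  | Imp "'p form" "'p form" (infixr \<open>\<^bold>\<rightarrow>\<close> 73)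
  | Box "'p form" (\<open>\<^bold>\<box> _\<close> [80] 80)

abbreviation Neg :: "'p form \<Rightarrow> 'p form" (\<open>\<^bold>\<not> _\<close> [80] 80) where
  "\<^bold>\<not> A \<equiv> A \<^bold>\<rightarrow> \<^bold>\<bottom>"

text \<open>A propositional logic is identified with its set of axioms; modus ponens is the only rule.
  None of the axiom schemes mentions the constant \<^const>\<open>Top\<close>.\<close>

inductive_set IPC :: "'p form set" where
  "A \<^bold>\<rightarrow> (B \<^bold>\<rightarrow> A) \<in> IPC"
| "(A \<^bold>\<rightarrow> B) \<^bold>\<rightarrow> ((A \<^bold>\<rightarrow> (B \<^bold>\<rightarrow> C)) \<^bold>\<rightarrow> (A \<^bold>\<rightarrow> C)) \<in> IPC"
| "A \<^bold>\<rightarrow> (A \<^bold>\<or> B) \<in> IPC"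
| "B \<^bold>\<rightarrow> (A \<^bold>\<or> B) \<in> IPC"
| "(A \<^bold>\<or> B) \<^bold>\<rightarrow> ((A \<^bold>\<rightarrow> C) \<^bold>\<rightarrow> ((B \<^bold>\<rightarrow> C) \<^bold>\<rightarrow> C)) \<in> IPC"
| "A \<^bold>\<rightarrow> (B \<^bold>\<rightarrow> (A \<^bold>\<and> B)) \<in> IPC"
| "(A \<^bold>\<and> B) \<^bold>\<rightarrow> A \<in> IPC"
| "(A \<^bold>\<and> B) \<^bold>\<rightarrow> B \<in> IPC"
| "\<^bold>\<bottom> \<^bold>\<rightarrow> A \<in> IPC"

definition CPC :: "'p form set" where
  "CPC = IPC \<union> {\<^bold>\<not> A \<^bold>\<or> A | A. True}"

inductive derives :: "'p form set \<Rightarrow> 'p form set \<Rightarrow> 'p form \<Rightarrow> bool"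
    (\<open>_ \<turnstile>[_] _\<close> [60, 0, 60] 60)
  for \<Gamma> L :: "'p form set" where
  hyp: "A \<in> \<Gamma> \<Longrightarrow> \<Gamma> \<turnstile>[L] A"
| ax: "A \<in> L \<Longrightarrow> \<Gamma> \<turnstile>[L] A"
| mp: "\<Gamma> \<turnstile>[L] A \<^bold>\<rightarrow> B \<Longrightarrow> \<Gamma> \<turnstile>[L] A \<Longrightarrow> \<Gamma> \<turnstile>[L] B"

inductive_set iK_bem :: "'p form set" where
  ipc: "A \<in> IPC \<Longrightarrow> A \<in> iK_bem"
| K: "\<^bold>\<box> (A \<^bold>\<rightarrow> B) \<^bold>\<rightarrow> (\<^bold>\<box> A \<^bold>\<rightarrow> \<^bold>\<box> B) \<in> iK_bem"
| bem: "\<^bold>\<box> A \<^bold>\<or> \<^bold>\<not> (\<^bold>\<box> A) \<in> iK_bem"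
| mp: "A \<^bold>\<rightarrow> B \<in> iK_bem \<Longrightarrow> A \<in> iK_bem \<Longrightarrow> B \<in> iK_bem"
| nec: "A \<in> iK_bem \<Longrightarrow> \<^bold>\<box> A \<in> iK_bem"

text \<open>Only the values of \<open>T\<close> on the carrier \<open>W\<close> are relevant.\<close>

definition mixed_model ::
  "'p form set set \<Rightarrow> 'w set \<Rightarrow> ('w \<times> 'w) set \<Rightarrow> ('w \<Rightarrow> 'p form set) \<Rightarrow> bool" where
  "mixed_model \<L> W R T \<longleftrightarrow>
     W \<noteq> {} \<and> R \<subseteq> W \<times> W \<and>
     (\<forall>w\<in>W. \<exists>L\<in>\<L>.
        \<^bold>\<bottom> \<notin> T w \<and>
        (\<forall>A. T w \<turnstile>[L] A \<longrightarrow> A \<in> T w) \<and>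
        (\<forall>A. \<^bold>\<box> A \<in> T w \<longleftrightarrow> (\<forall>v. (w, v) \<in> R \<longrightarrow> A \<in> T v)) \<and>
        (\<forall>A. \<^bold>\<not> (\<^bold>\<box> A) \<in> T w \<longleftrightarrow> (\<exists>v. (w, v) \<in> R \<and> A \<notin> T v)))"

text \<open>HOL cannot quantify over types inside a formula, so the type of worlds is an explicit
  parameter; validity in the whole class is obtained by leaving \<open>'w\<close> a free type variable.\<close>

definition MM_valid :: "'w itself \<Rightarrow> 'p form set set \<Rightarrow> 'p form \<Rightarrow> bool" where
  "MM_valid _ \<L> A \<longleftrightarrow>
     (\<forall>(W :: 'w set) R T. mixed_model \<L> W R T \<longrightarrow> (\<forall>w\<in>W. A \<in> T w))"

end

theory Submission
  imports Defs
begin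

text \<open>Conditions (3) and (4) on a mixed model together decide every boxed formula at every world:
  either \<open>\<box>A\<close> or \<open>\<not>\<box>A\<close> belongs to \<open>T w\<close>. This gives \<open>bem\<close> outright. For a decided antecedent,
  intuitionistic logic lets one prove an implication by assuming the antecedent, so \<open>K\<close> reduces to
  closure of the successors of \<open>w\<close> under modus ponens. Classical reasoning inside the worlds is never
  needed, so all that matters about the logics attached to them is that they extend \<open>IPC\<close>.\<close>

lemma derives_mono:
  assumes "\<Gamma> \<turnstile>[L] A" and "\<Gamma> \<subseteq> \<Delta>" and "L \<subseteq> L'"
  shows "\<Delta> \<turnstile>[L'] A"
  using assms by induction (auto intro: derives.intros)

context
  fixes L :: "'p form set"
  assumes IPC_subset: "IPC \<subseteq> L"
begin

lemma derives_IPC_axiom: "A \<in> IPC \<Longrightarrow> \<Gamma> \<turnstile>[L] A"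
  using IPC_subset by (blast intro: derives.ax)

lemma derives_Imp_if_consequent:
  assumes "\<Gamma> \<turnstile>[L] B"
  shows "\<Gamma> \<turnstile>[L] A \<^bold>\<rightarrow> B"
  using derives_IPC_axiom[OF IPC.intros(1)] assms by (rule derives.mp)

lemma derives_Imp_if_Neg_antecedent:
  assumes "\<Gamma> \<turnstile>[L] \<^bold>\<not> A"
  shows "\<Gamma> \<turnstile>[L] A \<^bold>\<rightarrow> B"
proof -
  have "\<Gamma> \<turnstile>[L] \<^bold>\<not> A \<^bold>\<rightarrow> ((A \<^bold>\<rightarrow> (\<^bold>\<bottom> \<^bold>\<rightarrow> B)) \<^bold>\<rightarrow> (A \<^bold>\<rightarrow> B))"
    by (rule derives_IPC_axiom[OF IPC.intros(2)])
  then have "\<Gamma> \<turnstile>[L] (A \<^bold>\<rightarrow> (\<^bold>\<bottom> \<^bold>\<rightarrow> B)) \<^bold>\<rightarrow> (A \<^bold>\<rightarrow> B)"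
    using assms by (rule derives.mp)
  moreover have "\<Gamma> \<turnstile>[L] A \<^bold>\<rightarrow> (\<^bold>\<bottom> \<^bold>\<rightarrow> B)"
    by (rule derives_Imp_if_consequent[OF derives_IPC_axiom[OF IPC.intros(9)]])
  ultimately show ?thesis
    by (rule derives.mp)
qed

lemma derives_Imp_if_decided:
  assumes "\<Gamma> \<turnstile>[L] A \<or> \<Gamma> \<turnstile>[L] \<^bold>\<not> A" and "\<Gamma> \<turnstile>[L] A \<Longrightarrow> \<Gamma> \<turnstile>[L] B"
  shows "\<Gamma> \<turnstile>[L] A \<^bold>\<rightarrow> B"
  using assms derives_Imp_if_consequent derives_Imp_if_Neg_antecedent by blast

lemma derives_DisjI1: "\<Gamma> \<turnstile>[L] A \<Longrightarrow> \<Gamma> \<turnstile>[L] A \<^bold>\<or> B"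
  by (rule derives.mp[OF derives_IPC_axiom[OF IPC.intros(3)]])

lemma derives_DisjI2: "\<Gamma> \<turnstile>[L] B \<Longrightarrow> \<Gamma> \<turnstile>[L] A \<^bold>\<or> B"
  by (rule derives.mp[OF derives_IPC_axiom[OF IPC.intros(4)]])

end

lemma mixed_model_successor:
  assumes "mixed_model \<L> W R T" and "(w, v) \<in> R"
  shows "v \<in> W"
  using assms by (auto simp: mixed_model_def)

lemma mixed_model_Box_iff:
  assumes "mixed_model \<L> W R T" and "w \<in> W"
  shows "\<^bold>\<box> A \<in> T w \<longleftrightarrow> (\<forall>v. (w, v) \<in> R \<longrightarrow> A \<in> T v)"
  using assms unfolding mixed_model_def by meson

lemma mixed_model_Neg_Box_iff:
  assumes "mixed_model \<L> W R T" and "w \<in> W"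
  shows "\<^bold>\<not> (\<^bold>\<box> A) \<in> T w \<longleftrightarrow> (\<exists>v. (w, v) \<in> R \<and> A \<notin> T v)"
  using assms unfolding mixed_model_def by meson

lemma mixed_model_Box_decided:
  assumes "mixed_model \<L> W R T" and "w \<in> W"
  shows "\<^bold>\<box> A \<in> T w \<or> \<^bold>\<not> (\<^bold>\<box> A) \<in> T w"
  using mixed_model_Box_iff[OF assms] mixed_model_Neg_Box_iff[OF assms] by blast

context
  fixes \<L> :: "'p form set set" and W :: "'w set" and R :: "('w \<times> 'w) set"
    and T :: "'w \<Rightarrow> 'p form set"
  assumes model: "mixed_model \<L> W R T" and extends_IPC: "\<And>L. L \<in> \<L> \<Longrightarrow> IPC \<subseteq> L"
begin

lemma mixed_model_derives_IPC_iff: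
  assumes "w \<in> W"
  shows "T w \<turnstile>[IPC] A \<longleftrightarrow> A \<in> T w"
proof
  assume "T w \<turnstile>[IPC] A"
  moreover obtain L where "L \<in> \<L>" and closed: "\<And>B. T w \<turnstile>[L] B \<Longrightarrow> B \<in> T w"
    using model assms unfolding mixed_model_def by meson
  ultimately have "T w \<turnstile>[L] A"
    using extends_IPC by (blast intro: derives_mono)
  then show "A \<in> T w"
    by (rule closed)
qed (rule derives.hyp)

lemma mixed_model_mp:
  assumes "w \<in> W" and "A \<^bold>\<rightarrow> B \<in> T w" and "A \<in> T w"
  shows "B \<in> T w"
  using assms by (metis derives.mp mixed_model_derives_IPC_iff)

lemma mixed_model_Imp_if_decided:
  assumes "w \<in> W" and "A \<in> T w \<or> \<^bold>\<not> A \<in> T w" and "A \<in> T w \<Longrightarrow> B \<in> T w"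
  shows "A \<^bold>\<rightarrow> B \<in> T w"
  using derives_Imp_if_decided[OF subset_refl, of "T w" A B] assms
  by (simp add: mixed_model_derives_IPC_iff)

lemma mixed_model_K:
  assumes "w \<in> W"
  shows "\<^bold>\<box> (A \<^bold>\<rightarrow> B) \<^bold>\<rightarrow> (\<^bold>\<box> A \<^bold>\<rightarrow> \<^bold>\<box> B) \<in> T w"
proof (intro mixed_model_Imp_if_decided mixed_model_Box_decided[OF model] assms)
  assume boxes: "\<^bold>\<box> (A \<^bold>\<rightarrow> B) \<in> T w" "\<^bold>\<box> A \<in> T w"
  have "B \<in> T v" if "(w, v) \<in> R" for v
  proof (rule mixed_model_mp)
    show "v \<in> W"
      by (rule mixed_model_successor[OF model that])
    show "A \<^bold>\<rightarrow> B \<in> T v" and "A \<in> T v"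
      using boxes that by (simp_all add: mixed_model_Box_iff[OF model assms])
  qed
  then show "\<^bold>\<box> B \<in> T w"
    by (simp add: mixed_model_Box_iff[OF model assms])
qed

lemma mixed_model_bem:
  assumes "w \<in> W"
  shows "\<^bold>\<box> A \<^bold>\<or> \<^bold>\<not> (\<^bold>\<box> A) \<in> T w"
proof -
  have "T w \<turnstile>[IPC] \<^bold>\<box> A \<^bold>\<or> \<^bold>\<not> (\<^bold>\<box> A)"
    using mixed_model_Box_decided[OF model assms]
    by (blast intro: derives.hyp derives_DisjI1[OF subset_refl] derives_DisjI2[OF subset_refl])
  then show ?thesis
    by (simp add: mixed_model_derives_IPC_iff[OF assms])
qed

lemma iK_bem_sound:
  assumes "A \<in> iK_bem" and "w \<in> W"
  shows "A \<in> T w"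
  using assms
proof (induction arbitrary: w)
  case (ipc A)
  then show ?case
    by (blast intro: derives.ax mixed_model_derives_IPC_iff[THEN iffD1])
next
  case (K A B)
  then show ?case
    by (rule mixed_model_K)
next
  case (bem A)
  then show ?case
    by (rule mixed_model_bem)
next
  case (mp A B)
  then show ?case
    by (blast intro: mixed_model_mp)
next
  case (nec A)
  then show ?case
    using mixed_model_Box_iff[OF model] mixed_model_successor[OF model] by blast
qed

end

theorem theorem3p2p1:
  fixes \<phi> :: "'p form"
  assumes "\<phi> \<in> iK_bem"
  shows "MM_valid TYPE('w) {CPC, IPC} \<phi>"
  unfolding MM_valid_def
proof (intro allI impI ballI)
  fix W :: "'w set" and R and T :: "'w \<Rightarrow> 'p form set" and w
  assume model: "mixed_model {CPC, IPC} W R T" and "w \<in> W"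
  have extends_IPC: "IPC \<subseteq> L" if "L \<in> {CPC, IPC}" for L :: "'p form set"
    using that by (auto simp: CPC_def)
  from model extends_IPC assms \<open>w \<in> W\<close> show "\<phi> \<in> T w"
    by (rule iK_bem_sound)
qed

end
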